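(* Let $X$ be a countably infinite set and let $I$ be an ideal on $X$ which is not dense. Then $\mathcal C_{\hat I}$ is precomplete, and it is in fact the only precomplete clone containing $\mathcal C_I$. Consequently, $\mathcal C_I$ is precomplete if and only if $I$ is regular.
   Context: Let $\mathcal O^{(n)}$ be the set of all functions $X^n\to X$ ($n\ge 1$) and $\mathcal O=\bigcup_{n\ge1}\mathcal O^{(n)}$. A clone on $X$ is a subset of $\mathcal O$ that contains all projections and is closed under composition. A clone $\mathcal C\neq\mathcal O$ is precomplete if there is no clone strictly between $\mathcal C$ and $\mathcal O$. An ideal on $X$ means here a family $I$ of subsets of $X$ that is closed under subsets and finite unions, contains all finite subsets of $X$, contains at least one infinite set, and does not contain all subsets of $X$. For an ideal $I$, $\mathcal C_I=\bigcup_{n\ge1}\{f\in\mathcal O^{(n)}: f[A^n]\in I\text{ for all }A\in I\}$. The regularization of $I$ is $\hat I=\{A\subseteq X:\text{ each infinite }B\subseteq A\text{ contains an infinite set }C\in I\}$. The ideal $I$ is dense if $\hat I$ is the full power set of $X$, and regular if $I=\hat I$. (If $I$ is not dense, then $\hat I$ is again an ideal, that is, a family of subsets of $X$ that is closed under subsets and finite unions, contains all finite subsets of $X$, contains at least one infinite set, and does not contain all subsets of $X$.) *)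

theory Defs
  imports "HOL-Library.FuncSet" "HOL-Library.NList" "HOL-Library.Countable_Set"
begin

text \<open>
  The base set \<open>X\<close> is the universe of the type \<open>'a\<close>, and \<open>A\<^sup>n\<close> is \<^term>\<open>nlists n A\<close>.
  An operation carries its arity explicitly; the function part is \<^const>\<open>undefined\<close> on lists of
  the wrong length, so that equality of operations is equality of functions \<open>X\<^sup>n \<rightarrow> X\<close>.
\<close>

type_synonym 'a operation = "nat \<times> ('a list \<Rightarrow> 'a)"

definition operations :: "'a operation set" where
  "operations = (SIGMA n:{1..}. nlists n UNIV \<rightarrow>\<^sub>E UNIV)"

definition projection :: "nat \<Rightarrow> nat \<Rightarrow> 'a operation" where
  "projection n i = (n, \<lambda>xs\<in>nlists n UNIV. xs ! i)"

text \<open>For \<open>f\<close> of arity \<^term>\<open>length gs\<close> and all members of \<open>gs\<close> of arity \<open>m\<close>.\<close>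

definition compose_operations ::
  "nat \<Rightarrow> ('a list \<Rightarrow> 'a) \<Rightarrow> ('a list \<Rightarrow> 'a) list \<Rightarrow> 'a operation" where
  "compose_operations m f gs = (m, \<lambda>xs\<in>nlists m UNIV. f (map (\<lambda>g. g xs) gs))"

definition clone :: "'a operation set \<Rightarrow> bool" where
  "clone C \<longleftrightarrow>
     C \<subseteq> operations \<and>
     (\<forall>n\<ge>1. \<forall>i<n. projection n i \<in> C) \<and>
     (\<forall>n f m gs. (n, f) \<in> C \<and> length gs = n \<and> (\<forall>g\<in>set gs. (m, g) \<in> C)
        \<longrightarrow> compose_operations m f gs \<in> C)"

definition precomplete :: "'a operation set \<Rightarrow> bool" where
  "precomplete C \<longleftrightarrow>
     clone C \<and> C \<noteq> operations \<and> \<not> (\<exists>D. clone D \<and> C \<subset> D \<and> D \<subset> operations)"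

definition set_ideal :: "'a set set \<Rightarrow> bool" where
  "set_ideal I \<longleftrightarrow>
     (\<forall>A\<in>I. \<forall>B\<subseteq>A. B \<in> I) \<and>
     (\<forall>A\<in>I. \<forall>B\<in>I. A \<union> B \<in> I) \<and>
     (\<forall>A. finite A \<longrightarrow> A \<in> I) \<and>
     (\<exists>A\<in>I. infinite A) \<and>
     I \<noteq> UNIV"

definition ideal_clone :: "'a set set \<Rightarrow> 'a operation set" where
  "ideal_clone I = {(n, f) \<in> operations. \<forall>A\<in>I. f ` nlists n A \<in> I}"

definition regularization :: "'a set set \<Rightarrow> 'a set set" where
  "regularization I =
     {A. \<forall>B. B \<subseteq> A \<and> infinite B \<longrightarrow> (\<exists>C. C \<subseteq> B \<and> infinite C \<and> C \<in> I)}"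

definition dense_ideal :: "'a set set \<Rightarrow> bool" where
  "dense_ideal I \<longleftrightarrow> regularization I = UNIV"

definition regular_ideal :: "'a set set \<Rightarrow> bool" where
  "regular_ideal I \<longleftrightarrow> I = regularization I"

end

theory Submission
  imports Defs
begin

text \<open>
  Call a set \<open>S\<close> orthogonal to \<open>I\<close> if it has no infinite subset in \<open>I\<close>, so that it
  meets every member of \<open>I\<close> in a finite set. A set belongs to the regularization of \<open>I\<close> exactly if
  it has no infinite subset orthogonal to \<open>I\<close>, and \<open>I\<close> is dense exactly if no infinite set is
  orthogonal to \<open>I\<close>.

  The heart of the matter is a dichotomy: a clone \<open>D\<close> above the clone of \<open>I\<close> either lies below the
  clone of the regularization or consists of all operations. Indeed, suppose that \<open>f \<in> D\<close> maps
  tuples over some \<open>A\<close> in the regularization onto a set outside it. Then \<open>f\<close> takes infinitely many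
  values in an orthogonal set \<open>S\<close> on such tuples. Thinning out one coordinate after the other, one
  finds infinitely many of these tuples, with distinct values, over a single member of \<open>I\<close>
  (\<open>infinite_fibre_in_ideal\<close>). Functions with range in a member of \<open>I\<close> preserve \<open>I\<close>, so
  enumerating these tuples along \<open>X\<close> and applying \<open>f\<close> gives an injection \<open>h: X \<rightarrow> S\<close> in \<open>D\<close>.
  Members of \<open>I\<close> meet \<open>S\<close> in finite sets, and so operations whose behaviour is arbitrary on
  tuples over \<open>S\<close> and constant elsewhere preserve \<open>I\<close>. Every operation \<open>q\<close> can
  therefore be written as \<open>p(h(x\<^sub>1),\<dots>,h(x\<^sub>n))\<close> with \<open>p\<close> preserving \<open>I\<close>
  (\<open>clone_with_orthogonal_injection_is_full\<close>).

  The same thinning argument shows that operations preserving \<open>I\<close> preserve its regularization, and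
  so both precompleteness and uniqueness follow from the dichotomy. The criterion for the clone of
  \<open>I\<close> itself follows because an ideal can be recovered from its clone: the nonempty
  members of an ideal are the images of one infinite member under unary operations of the clone.
\<close>

section \<open>Operations and clones\<close>

declare in_nlists_UNIV [simp]

lemma finite_nlists: "finite A \<Longrightarrow> finite (nlists n A)"
  unfolding nlists_def by (rule finite_subset[OF _ finite_lists_length_eq[of A n]]) auto

lemma restrict_in_operations_iff [simp]:
  "(n, \<lambda>xs\<in>nlists n UNIV. F xs) \<in> operations \<longleftrightarrow> 1 \<le> n"
  by (simp add: operations_def PiE_def)

lemma operation_eq_restrict: "(n, f) \<in> operations \<Longrightarrow> f = (\<lambda>xs\<in>nlists n UNIV. f xs)"
  by (simp add: operations_def PiE_def extensional_restrict)

lemma clone_compose: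
  "clone C \<Longrightarrow> (n, f) \<in> C \<Longrightarrow> length gs = n \<Longrightarrow> (\<And>g. g \<in> set gs \<Longrightarrow> (m, g) \<in> C)
    \<Longrightarrow> compose_operations m f gs \<in> C"
  by (simp add: clone_def)

lemma clone_compose_tuple:
  assumes "clone C" "(n, f) \<in> C"
    and "\<And>i. i < n \<Longrightarrow> (m, \<lambda>xs\<in>nlists m UNIV. t xs ! i) \<in> C"
    and "\<And>xs. length xs = m \<Longrightarrow> length (t xs) = n"
  shows "(m, \<lambda>xs\<in>nlists m UNIV. f (t xs)) \<in> C"
proof -
  define gs where "gs = map (\<lambda>i. \<lambda>xs\<in>nlists m UNIV. t xs ! i) [0..<n]"
  have "map (\<lambda>g. g xs) gs = t xs" if "length xs = m" for xs
    using assms(4)[OF that] that by (intro nth_equalityI) (simp_all add: gs_def)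
  then have "compose_operations m f gs = (m, \<lambda>xs\<in>nlists m UNIV. f (t xs))"
    unfolding compose_operations_def by (intro arg_cong[where f = "Pair m"] restrict_ext) simp
  moreover have "compose_operations m f gs \<in> C"
  proof (rule clone_compose[OF assms(1,2)])
    show "length gs = n" by (simp add: gs_def)
    show "(m, g) \<in> C" if "g \<in> set gs" for g
      using that assms(3) by (auto simp: gs_def)
  qed
  ultimately show ?thesis by simp
qed

lemma clone_projection:
  assumes "clone C" "i < n"
  shows "(n, \<lambda>xs\<in>nlists n UNIV. xs ! i) \<in> C"
proof -
  have "1 \<le> n" using assms(2) by linarith
  with assms have "projection n i \<in> C" unfolding clone_def by blast
  then show ?thesis by (simp only: projection_def)
qed

lemma clone_subset_operations: "clone C \<Longrightarrow> C \<subseteq> operations"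
  by (simp add: clone_def)

definition unary_operation :: "('a \<Rightarrow> 'a) \<Rightarrow> 'a operation" where
  "unary_operation g = (1, \<lambda>xs\<in>nlists 1 UNIV. g (xs ! 0))"

text \<open>For injective \<open>h\<close> this is the form in which every operation will be factorized.\<close>

lemma clone_apply_coordinatewise:
  assumes "clone C" "(n, p) \<in> C" "unary_operation h \<in> C"
  shows "(n, \<lambda>xs\<in>nlists n UNIV. p (map h xs)) \<in> C"
proof (rule clone_compose_tuple[OF assms(1,2)])
  fix i assume i: "i < n"
  have "(n, \<lambda>xs\<in>nlists n UNIV. (\<lambda>ys\<in>nlists 1 UNIV. h (ys ! 0)) [xs ! i]) \<in> C"
  proof (rule clone_compose_tuple[OF assms(1)])
    show "(1, \<lambda>ys\<in>nlists 1 UNIV. h (ys ! 0)) \<in> C"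
      using assms(3) by (simp only: unary_operation_def)
  qed (simp_all add: clone_projection[OF assms(1) i])
  moreover have "(\<lambda>xs\<in>nlists n UNIV. (\<lambda>ys\<in>nlists 1 UNIV. h (ys ! 0)) [xs ! i])
      = (\<lambda>xs\<in>nlists n UNIV. map h xs ! i)"
    using i by (intro restrict_ext) simp
  ultimately show "(n, \<lambda>xs\<in>nlists n UNIV. map h xs ! i) \<in> C" by simp
qed simp

section \<open>Clones of ideals\<close>

lemma set_ideal_subset: "set_ideal I \<Longrightarrow> A \<in> I \<Longrightarrow> B \<subseteq> A \<Longrightarrow> B \<in> I"
  unfolding set_ideal_def by blast

lemma set_ideal_Un: "set_ideal I \<Longrightarrow> A \<in> I \<Longrightarrow> B \<in> I \<Longrightarrow> A \<union> B \<in> I"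
  unfolding set_ideal_def by blast

lemma set_ideal_finite: "set_ideal I \<Longrightarrow> finite A \<Longrightarrow> A \<in> I"
  unfolding set_ideal_def by blast

lemma set_ideal_infinite_member: "set_ideal I \<Longrightarrow> \<exists>A\<in>I. infinite A"
  unfolding set_ideal_def by blast

lemma set_ideal_UN:
  assumes "set_ideal I" "finite K" "\<And>k. k \<in> K \<Longrightarrow> A k \<in> I"
  shows "(\<Union>k\<in>K. A k) \<in> I"
  using assms(2,3)
  by (induction K rule: finite_induct)
    (simp_all add: set_ideal_Un[OF assms(1)] set_ideal_finite[OF assms(1)])

lemma UNIV_notin_set_ideal: "set_ideal I \<Longrightarrow> UNIV \<notin> I"
  unfolding set_ideal_def by (metis UNIV_eq_I top_greatest)

lemma ideal_cloneD: "(n, f) \<in> ideal_clone I \<Longrightarrow> A \<in> I \<Longrightarrow> f ` nlists n A \<in> I"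
  by (simp add: ideal_clone_def)

lemma ideal_clone_arity: "(n, f) \<in> ideal_clone I \<Longrightarrow> 1 \<le> n"
  by (simp add: ideal_clone_def operations_def)

lemma clone_ideal_clone:
  assumes "set_ideal I"
  shows "clone (ideal_clone I)"
  unfolding clone_def
proof (intro conjI allI impI)
  show "ideal_clone I \<subseteq> operations" by (auto simp: ideal_clone_def)
next
  fix n i :: nat assume "1 \<le> n" "i < n"
  moreover have "(\<lambda>xs\<in>nlists n UNIV. xs ! i) ` nlists n A \<in> I" if "A \<in> I" for A
    using \<open>i < n\<close> by (intro set_ideal_subset[OF assms that]) (auto simp: nlistsE_nth_in)
  ultimately show "projection n i \<in> ideal_clone I"
    by (simp add: ideal_clone_def projection_def)
next
  fix n f m gs
  assume "(n, f) \<in> ideal_clone I \<and> length gs = n \<and> (\<forall>g\<in>set gs. (m, g) \<in> ideal_clone I)"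
  then have f: "(n, f) \<in> ideal_clone I" and gs: "length gs = n"
    and g: "\<And>g. g \<in> set gs \<Longrightarrow> (m, g) \<in> ideal_clone I" by blast+
  have "gs ! 0 \<in> set gs" using ideal_clone_arity[OF f] gs by simp
  then have m: "1 \<le> m" using g ideal_clone_arity by blast
  have "(\<lambda>xs\<in>nlists m UNIV. f (map (\<lambda>g. g xs) gs)) ` nlists m A \<in> I" if "A \<in> I" for A
  proof -
    define E where "E = (\<Union>g\<in>set gs. g ` nlists m A)"
    have "E \<in> I"
      unfolding E_def using ideal_cloneD[OF g that] by (intro set_ideal_UN[OF assms]) simp_all
    then have "f ` nlists n E \<in> I" by (rule ideal_cloneD[OF f])
    moreover have "map (\<lambda>g. g xs) gs \<in> nlists n E" if "xs \<in> nlists m A" for xs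
      using that gs by (intro nlistsI) (auto simp: E_def)
    then have "(\<lambda>xs\<in>nlists m UNIV. f (map (\<lambda>g. g xs) gs)) ` nlists m A \<subseteq> f ` nlists n E"
      by (auto dest: nlistsE_length)
    ultimately show ?thesis by (rule set_ideal_subset[OF assms])
  qed
  with m show "compose_operations m f gs \<in> ideal_clone I"
    by (simp add: compose_operations_def ideal_clone_def)
qed

lemma operation_with_range_in_ideal:
  assumes "set_ideal I" "A \<in> I" "1 \<le> n" and "\<And>xs. length xs = n \<Longrightarrow> F xs \<in> A"
  shows "(n, \<lambda>xs\<in>nlists n UNIV. F xs) \<in> ideal_clone I"
proof -
  have "(\<lambda>xs\<in>nlists n UNIV. F xs) ` nlists n B \<subseteq> A" for B
    using assms(4) by (simp add: image_subset_iff)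
  then have "(\<lambda>xs\<in>nlists n UNIV. F xs) ` nlists n B \<in> I" for B
    by (rule set_ideal_subset[OF assms(1,2)])
  then show ?thesis using assms(3) by (simp add: ideal_clone_def)
qed

lemma unary_operation_image_in_ideal:
  assumes "unary_operation g \<in> ideal_clone I" "A \<in> I"
  shows "g ` A \<in> I"
proof -
  have "nlists 1 A = (\<lambda>x. [x]) ` A" by (simp add: nlists_Suc UNION_singleton_eq_range)
  then have "(\<lambda>xs\<in>nlists 1 UNIV. g (xs ! 0)) ` nlists 1 A = g ` A"
    by (simp only: image_image) simp
  with ideal_cloneD[OF assms(1)[unfolded unary_operation_def] assms(2)] show ?thesis by simp
qed

section \<open>Countability\<close>

lemma countable_inject_into_infinite:
  assumes "countable (UNIV :: 'a set)" "infinite U"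
  obtains t :: "'a \<Rightarrow> 'b" where "inj t" "range t \<subseteq> U"
proof -
  obtain e :: "nat \<Rightarrow> 'b" where e: "inj e" "range e \<subseteq> U"
    using infinite_countable_subset[OF assms(2)] by auto
  have "inj (e \<circ> to_nat_on (UNIV :: 'a set))"
    using e(1) inj_on_to_nat_on[OF assms(1)] by (auto intro: inj_compose)
  with e(2) that show thesis by fastforce
qed

text \<open>Turning an injection of \<open>X\<close> into \<open>B\<close> around yields a map of \<open>X\<close> that is onto \<open>A\<close> already on
  \<open>B\<close>.\<close>

lemma countable_map_infinite_onto:
  assumes "countable (UNIV :: 'a set)" "infinite B" "A \<noteq> {}"
  obtains g :: "'a \<Rightarrow> 'a" where "g ` B = A" "range g = A"
proof -
  obtain t :: "'a \<Rightarrow> 'a" where t: "inj t" "range t \<subseteq> B"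
    using countable_inject_into_infinite[OF assms(1,2)] .
  obtain a where a: "a \<in> A" using assms(3) by auto
  define g where "g = (\<lambda>x. if inv t x \<in> A then inv t x else a)"
  have "A \<subseteq> g ` B"
  proof
    fix y assume "y \<in> A"
    then have "g (t y) = y" using t(1) by (simp add: g_def)
    with t(2) show "y \<in> g ` B" by (metis image_eqI range_subsetD)
  qed
  moreover have "range g \<subseteq> A" using a by (auto simp: g_def)
  ultimately show thesis using that[of g] by blast
qed

text \<open>A nonempty member \<open>A\<close> of \<open>J\<close> is the range of a unary operation that preserves \<open>J\<close> and maps any given
  infinite set onto \<open>A\<close>, in particular one that lies in \<open>I\<close>.\<close>

lemma ideal_subset_if_ideal_clone_subset:
  assumes "countable (UNIV :: 'a set)" "set_ideal (I :: 'a set set)" "set_ideal J"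
    and "ideal_clone J \<subseteq> ideal_clone I"
  shows "J \<subseteq> I"
proof
  fix A assume A: "A \<in> J"
  show "A \<in> I"
  proof (cases "A = {}")
    case True
    then show ?thesis by (simp add: set_ideal_finite[OF assms(2)])
  next
    case False
    obtain B where B: "B \<in> I" "infinite B" using set_ideal_infinite_member[OF assms(2)] by auto
    obtain g where g: "g ` B = A" "range g = A"
      using countable_map_infinite_onto[OF assms(1) B(2) False] .
    have "unary_operation g \<in> ideal_clone J"
      unfolding unary_operation_def using g
      by (intro operation_with_range_in_ideal[OF assms(3) A]) auto
    with assms(4) have "g ` B \<in> I"
      by (intro unary_operation_image_in_ideal B) auto
    with g show ?thesis by simp
  qed
qed

text \<open>A unary operation that maps an infinite member of \<open>I\<close> onto \<open>X\<close> does not preserve \<open>I\<close>.\<close>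

lemma ideal_clone_neq_operations:
  assumes "countable (UNIV :: 'a set)" "set_ideal (I :: 'a set set)"
  shows "ideal_clone I \<noteq> operations"
proof
  assume eq: "ideal_clone I = operations"
  obtain B where B: "B \<in> I" "infinite B" using set_ideal_infinite_member[OF assms(2)] by auto
  obtain g :: "'a \<Rightarrow> 'a" where g: "g ` B = UNIV"
    using countable_map_infinite_onto[OF assms(1) B(2) UNIV_not_empty] .
  have "unary_operation g \<in> ideal_clone I" by (simp add: eq unary_operation_def)
  from unary_operation_image_in_ideal[OF this B(1)] g UNIV_notin_set_ideal[OF assms(2)]
  show False by simp
qed

section \<open>Regularization\<close>

lemma subset_regularization: "set_ideal I \<Longrightarrow> I \<subseteq> regularization I"
  unfolding regularization_def by (blast dest: set_ideal_subset)

lemma set_ideal_regularization: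
  assumes "set_ideal I" "\<not> dense_ideal I"
  shows "set_ideal (regularization I)"
  unfolding set_ideal_def
proof (intro conjI ballI allI impI)
  fix A B assume A: "A \<in> regularization I" and B: "B \<in> regularization I"
  have "\<exists>D\<subseteq>C. infinite D \<and> D \<in> I" if C: "C \<subseteq> A \<union> B" "infinite C" for C
  proof -
    have "C = C \<inter> A \<union> C \<inter> B" using C by auto
    then have "infinite (C \<inter> A) \<or> infinite (C \<inter> B)" using C(2) by (metis finite_Un)
    then show ?thesis
      using A B unfolding regularization_def by (smt (verit) Int_subset_iff mem_Collect_eq subset_refl)
  qed
  then show "A \<union> B \<in> regularization I" by (simp add: regularization_def)
next
  fix A B assume "A \<in> regularization I" "B \<subseteq> A"
  then show "B \<in> regularization I" by (auto simp: regularization_def)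
next
  fix A :: "'a set" assume "finite A"
  then show "A \<in> regularization I" by (auto simp: regularization_def dest: finite_subset)
next
  show "\<exists>A\<in>regularization I. infinite A"
    using set_ideal_infinite_member subset_regularization assms(1) by blast
next
  show "regularization I \<noteq> UNIV" using assms(2) by (simp add: dense_ideal_def)
qed

text \<open>By induction on the number of coordinates: if \<open>f n\<close> takes finitely many values on what is
  left of \<open>T\<close>, these values form a member of \<open>I\<close>; otherwise they contain an infinite member of
  \<open>I\<close>, whose preimage is still infinite.\<close>

lemma infinite_fibre_in_ideal:
  fixes n :: nat
  assumes "set_ideal I" "A \<in> regularization I" "infinite T"
    and "\<And>t i. t \<in> T \<Longrightarrow> i < n \<Longrightarrow> f i t \<in> A"
  shows "\<exists>D\<in>I. infinite {t \<in> T. \<forall>i<n. f i t \<in> D}"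
  using assms(4)
proof (induction n)
  case 0
  show ?case using assms(3) set_ideal_finite[OF assms(1), of "{}"] by auto
next
  case (Suc n)
  then obtain D where D: "D \<in> I" "infinite {t \<in> T. \<forall>i<n. f i t \<in> D}" by force
  define T' where "T' = {t \<in> T. \<forall>i<n. f i t \<in> D}"
  have "\<exists>E\<in>I. infinite {t \<in> T'. f n t \<in> E}"
  proof (cases "finite (f n ` T')")
    case True
    have "{t \<in> T'. f n t \<in> f n ` T'} = T'" by auto
    then show ?thesis
      using D(2) by (intro bexI[of _ "f n ` T'"] set_ideal_finite[OF assms(1) True])
        (simp add: T'_def)
  next
    case False
    have "f n ` T' \<subseteq> A" using Suc.prems by (auto simp: T'_def)
    with False obtain E where E: "E \<subseteq> f n ` T'" "infinite E" "E \<in> I"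
      using assms(2) unfolding regularization_def by blast
    have "E \<subseteq> f n ` {t \<in> T'. f n t \<in> E}" using E(1) by auto
    with E(2) have "infinite {t \<in> T'. f n t \<in> E}" by (meson finite_imageI finite_subset)
    with E(3) show ?thesis by auto
  qed
  then obtain E where E: "E \<in> I" "infinite {t \<in> T'. f n t \<in> E}" by auto
  have "{t \<in> T'. f n t \<in> E} \<subseteq> {t \<in> T. \<forall>i<Suc n. f i t \<in> D \<union> E}"
    by (auto simp: T'_def less_Suc_eq)
  with E(2) have "infinite {t \<in> T. \<forall>i<Suc n. f i t \<in> D \<union> E}" by (meson finite_subset)
  with set_ideal_Un[OF assms(1) D(1) E(1)] show ?case by blast
qed

text \<open>This is how a set of values over a member of the regularization is traced back to tuples over
  a member of \<open>I\<close> itself. Values are kept distinct so that infinitely many of them survive.\<close>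

lemma infinite_values_over_ideal:
  assumes "set_ideal I" "A \<in> regularization I" "infinite B" "B \<subseteq> f ` nlists n A"
  obtains D U where "D \<in> I" "U \<subseteq> nlists n D" "infinite U" "inj_on f U" "f ` U \<subseteq> B"
proof -
  obtain T where T: "T \<subseteq> nlists n A" "inj_on f T" "B = f ` T"
    using assms(4) by (auto simp: subset_image_inj)
  have "infinite T" using T(3) assms(3) by auto
  then obtain D where D: "D \<in> I" "infinite {t \<in> T. \<forall>i<n. t ! i \<in> D}"
    using infinite_fibre_in_ideal[OF assms(1,2), of T n "\<lambda>i t. t ! i"] T(1) nlistsE_nth_in by blast
  show thesis
  proof (rule that[OF D(1) _ D(2)])
    show "{t \<in> T. \<forall>i<n. t ! i \<in> D} \<subseteq> nlists n D"
      using T(1) by (fastforce intro!: nlistsI simp: in_set_conv_nth)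
    show "inj_on f {t \<in> T. \<forall>i<n. t ! i \<in> D}" using T(2) by (rule inj_on_subset) auto
    show "f ` {t \<in> T. \<forall>i<n. t ! i \<in> D} \<subseteq> B" using T(3) by auto
  qed
qed

lemma ideal_clone_subset_regularization:
  assumes "set_ideal I"
  shows "ideal_clone I \<subseteq> ideal_clone (regularization I)"
proof
  fix F assume "F \<in> ideal_clone I"
  then obtain n f where F: "F = (n, f)" "(n, f) \<in> operations"
    and f: "\<And>A. A \<in> I \<Longrightarrow> f ` nlists n A \<in> I"
    by (auto simp: ideal_clone_def)
  have "\<exists>C\<subseteq>B. infinite C \<and> C \<in> I"
    if A: "A \<in> regularization I" and B: "B \<subseteq> f ` nlists n A" "infinite B" for A B
  proof -
    obtain D U where U: "D \<in> I" "U \<subseteq> nlists n D" "infinite U" "inj_on f U" "f ` U \<subseteq> B"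
      using infinite_values_over_ideal[OF assms A B(2,1)] .
    have "infinite (f ` U)" using U(3,4) by (simp add: finite_image_iff)
    moreover have "f ` U \<in> I"
      by (rule set_ideal_subset[OF assms f[OF U(1)] image_mono[OF U(2)]])
    ultimately show ?thesis using U(5) by auto
  qed
  then have "\<forall>A\<in>regularization I. f ` nlists n A \<in> regularization I"
    by (simp add: regularization_def)
  with F show "F \<in> ideal_clone (regularization I)" by (simp add: ideal_clone_def)
qed

section \<open>The dichotomy\<close>

text \<open>The outer operation \<open>p\<close> undoes \<open>h\<close> and applies \<open>q\<close> on tuples over the range of \<open>h\<close>, and is
  constant elsewhere. A member of \<open>I\<close> meets the range in a finite set, so \<open>p\<close> takes only finitely
  many values on tuples over it.\<close>

lemma clone_with_orthogonal_injection_is_full: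
  fixes I :: "'a set set"
  assumes "set_ideal I" "clone D" "ideal_clone I \<subseteq> D"
    and "unary_operation h \<in> D" "inj h"
    and orthogonal: "\<And>A. A \<in> I \<Longrightarrow> finite (A \<inter> range h)"
  shows "D = operations"
proof
  show "D \<subseteq> operations" using assms(2) by (rule clone_subset_operations)
  show "operations \<subseteq> D"
  proof
    fix Q :: "'a operation" assume Q: "Q \<in> operations"
    obtain n q where nq: "Q = (n, q)" by (cases Q)
    with Q have q: "(n, q) \<in> operations" and "1 \<le> n" by (simp_all add: operations_def)
    define p where "p = (\<lambda>ys\<in>nlists n UNIV.
      if set ys \<subseteq> range h then q (map (inv h) ys) else undefined)"
    have "p ` nlists n A \<in> I" if "A \<in> I" for A
    proof (rule set_ideal_finite[OF assms(1)])
      let ?V = "insert undefined ((\<lambda>ys. q (map (inv h) ys)) ` nlists n (A \<inter> range h))"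
      have "p ys \<in> ?V" if "ys \<in> nlists n A" for ys
      proof (cases "set ys \<subseteq> range h")
        case True
        with nlistsE_set[OF that] have "set ys \<subseteq> A \<inter> range h" by blast
        then have "ys \<in> nlists n (A \<inter> range h)" by (rule nlistsI[OF nlistsE_length[OF that]])
        moreover have "p ys = q (map (inv h) ys)" using True that by (simp add: p_def)
        ultimately show ?thesis by blast
      next
        case False
        with that show ?thesis by (simp add: p_def)
      qed
      then have "p ` nlists n A \<subseteq> ?V" by (rule image_subsetI)
      moreover have "finite ?V" using orthogonal[OF that] by (simp add: finite_nlists)
      ultimately show "finite (p ` nlists n A)" by (rule finite_subset)
    qed
    moreover have "(n, p) \<in> operations" using \<open>1 \<le> n\<close> by (simp add: p_def)
    ultimately have "(n, p) \<in> ideal_clone I" by (simp add: ideal_clone_def)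
    with assms(3) have "(n, p) \<in> D" by (rule subsetD)
    then have "(n, \<lambda>xs\<in>nlists n UNIV. p (map h xs)) \<in> D"
      by (rule clone_apply_coordinatewise[OF assms(2) _ assms(4)])
    moreover have "p (map h xs) = q xs" if "length xs = n" for xs
    proof -
      have "map (inv h) (map h xs) = xs" using assms(5) by simp
      moreover have "set (map h xs) \<subseteq> range h" by auto
      ultimately show ?thesis using that by (simp add: p_def del: map_map)
    qed
    then have "(\<lambda>xs\<in>nlists n UNIV. p (map h xs)) = (\<lambda>xs\<in>nlists n UNIV. q xs)"
      by (intro restrict_ext) simp
    ultimately have "(n, \<lambda>xs\<in>nlists n UNIV. q xs) \<in> D" by (simp only:)
    then show "Q \<in> D" by (simp only: nq operation_eq_restrict[OF q, symmetric])
  qed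
qed

lemma clone_above_ideal_clone:
  fixes I :: "'a set set"
  assumes "countable (UNIV :: 'a set)" "set_ideal I" "clone D" "ideal_clone I \<subseteq> D"
  shows "D \<subseteq> ideal_clone (regularization I) \<or> D = operations"
proof (rule disjCI)
  assume "D \<noteq> operations"
  show "D \<subseteq> ideal_clone (regularization I)"
  proof (rule ccontr)
    assume "\<not> D \<subseteq> ideal_clone (regularization I)"
    then obtain n f where nf: "(n, f) \<in> D" "(n, f) \<notin> ideal_clone (regularization I)" by auto
    then have "(n, f) \<in> operations" using clone_subset_operations[OF assms(3)] by auto
    with nf obtain A where A: "A \<in> regularization I" "f ` nlists n A \<notin> regularization I"
      by (auto simp: ideal_clone_def)
    then obtain S where S: "S \<subseteq> f ` nlists n A" "infinite S"
      and orthogonal: "\<And>C. C \<subseteq> S \<Longrightarrow> C \<in> I \<Longrightarrow> finite C"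
      unfolding regularization_def by blast
    obtain E U where U: "E \<in> I" "U \<subseteq> nlists n E" "infinite U" "inj_on f U" "f ` U \<subseteq> S"
      using infinite_values_over_ideal[OF assms(2) A(1) S(2,1)] .
    obtain t :: "'a \<Rightarrow> 'a list" where t: "inj t" "range t \<subseteq> U"
      using countable_inject_into_infinite[OF assms(1) U(3)] .
    have tE: "t x \<in> nlists n E" for x using t(2) U(2) by blast
    let ?h = "\<lambda>x. f (t x)"
    \<comment> \<open>Each coordinate of \<open>t\<close> has its range in \<open>E\<close> and hence belongs to the clone of \<open>I\<close>.\<close>
    have "(1, \<lambda>xs\<in>nlists 1 UNIV. t (xs ! 0) ! i) \<in> ideal_clone I" if "i < n" for i
      using nlistsE_nth_in[OF tE that] by (intro operation_with_range_in_ideal[OF assms(2) U(1)]) auto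
    with assms(4) have coordinates: "(1, \<lambda>xs\<in>nlists 1 UNIV. t (xs ! 0) ! i) \<in> D" if "i < n" for i
      using that by blast
    have "unary_operation ?h \<in> D"
      unfolding unary_operation_def
      by (rule clone_compose_tuple[OF assms(3) nf(1) coordinates nlistsE_length[OF tE]])
    moreover have "inj ?h"
      using comp_inj_on[OF t(1), of f] inj_on_subset[OF U(4) t(2)] by (simp add: comp_def)
    moreover have "finite (C \<inter> range ?h)" if "C \<in> I" for C
    proof (rule orthogonal)
      show "C \<inter> range ?h \<subseteq> S" using t(2) U(5) by auto
      show "C \<inter> range ?h \<in> I" using set_ideal_subset[OF assms(2) that] by simp
    qed
    ultimately have "D = operations"
      by (intro clone_with_orthogonal_injection_is_full[OF assms(2-4)])
    with \<open>D \<noteq> operations\<close> show False ..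
  qed
qed

theorem proposition17:
  fixes I :: "'a set set"
  assumes "countable (UNIV :: 'a set)" and "infinite (UNIV :: 'a set)"
    and "set_ideal I" and "\<not> dense_ideal I"
  shows "precomplete (ideal_clone (regularization I)) \<and>
         ideal_clone I \<subseteq> ideal_clone (regularization I) \<and>
         (\<forall>D. precomplete D \<and> ideal_clone I \<subseteq> D \<longrightarrow> D = ideal_clone (regularization I)) \<and>
         (precomplete (ideal_clone I) \<longleftrightarrow> regular_ideal I)"
proof -
  let ?J = "regularization I"
  note J = set_ideal_regularization[OF assms(3,4)]
  note sub = ideal_clone_subset_regularization[OF assms(3)]
  note dichotomy = clone_above_ideal_clone[OF assms(1,3)]
  have cloneJ: "clone (ideal_clone ?J)" using J by (rule clone_ideal_clone)
  have properJ: "ideal_clone ?J \<subset> operations"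
    using clone_subset_operations[OF cloneJ] ideal_clone_neq_operations[OF assms(1) J] by auto
  have precompleteJ: "precomplete (ideal_clone ?J)"
    unfolding precomplete_def
  proof (intro conjI notI)
    assume "\<exists>D. clone D \<and> ideal_clone ?J \<subset> D \<and> D \<subset> operations"
    then obtain D where "clone D" "ideal_clone ?J \<subset> D" "D \<subset> operations" by auto
    with dichotomy[of D] sub show False by auto
  qed (use cloneJ properJ in auto)
  have unique: "D = ideal_clone ?J" if "precomplete D" "ideal_clone I \<subseteq> D" for D
  proof -
    have "D \<subseteq> ideal_clone ?J"
      using dichotomy[of D] that by (auto simp: precomplete_def)
    with that(1) cloneJ properJ show ?thesis unfolding precomplete_def by blast
  qed
  have "precomplete (ideal_clone I) \<longleftrightarrow> regular_ideal I"
  proof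
    assume "precomplete (ideal_clone I)"
    then have "ideal_clone I = ideal_clone ?J" by (intro unique) auto
    then have "?J \<subseteq> I"
      by (intro ideal_subset_if_ideal_clone_subset[OF assms(1,3) J]) simp
    with subset_regularization[OF assms(3)] show "regular_ideal I"
      by (auto simp: regular_ideal_def)
  next
    assume "regular_ideal I"
    with precompleteJ show "precomplete (ideal_clone I)" by (simp add: regular_ideal_def)
  qed
  with precompleteJ sub unique show ?thesis by blast
qed

end
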